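(* Let $R$ be a unital commutative ring in which $6$ is invertible and let $n\geq 3$. Then for all $p,q\in\{1,2,\dots,n\}$ with $p\neq q$ the matrix unit $e_{pq}$ is a Jordan product determined point in $M_n(R)$.
   Context: $M_n(R)$ is the algebra of all $n\times n$ matrices over $R$; $e_{ij}$ denotes the matrix unit with $1$ in position $(i,j)$ and $0$ elsewhere. The Jordan product is $x\circ y=xy+yx$. $M_n(R)^2$ denotes the $R$-linear span of all elements of the form $xy$ with $x,y\in M_n(R)$. An $R$-bilinear map $\{\cdot,\cdot\}:M_n(R)\times M_n(R)\to X$ is symmetric if $\{x,y\}=\{y,x\}$ for all $x,y$. A matrix $A\in M_n(R)$ is called a Jordan product determined point (in $M_n(R)$) if for every $R$-module $X$ and every symmetric $R$-bilinear map $\{\cdot,\cdot\}:M_n(R)\times M_n(R)\to X$ the following two conditions are equivalent: (i) there exists a fixed element $w\in X$ such that $\{x,y\}=w$ whenever $x,y\in M_n(R)$ satisfy $x\circ y=A$; (ii) there exists an $R$-linear map $T:M_n(R)^2\to X$ such that $\{x,y\}=T(x\circ y)$ for all $x,y\in M_n(R)$. *)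

theory Defs
  imports "Jordan_Normal_Form.Matrix"
begin

text \<open>Commutative rings with \<open>1\<close>, including the zero ring, which \<open>comm_ring_1\<close> excludes by
  its axiom \<open>0 \<noteq> 1\<close>. The numeral classes contribute syntax, but no further axioms.\<close>

class unital_comm_ring = comm_ring + comm_monoid_mult + semiring_numeral + neg_numeral

subclass (in comm_ring_1) unital_comm_ring ..

text \<open>The axioms of the library locale \<open>Modules.module\<close>, which itself requires \<open>comm_ring_1\<close>.\<close>

locale unital_module =
  fixes scale :: "'r::unital_comm_ring \<Rightarrow> 'x::ab_group_add \<Rightarrow> 'x"
  assumes scale_right_distrib: "scale a (x + y) = scale a x + scale a y"
    and scale_left_distrib: "scale (a + b) x = scale a x + scale b x"
    and scale_scale: "scale a (scale b x) = scale (a * b) x"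
    and scale_one: "scale 1 x = x"

definition jordan_prod :: "'r::semiring_0 mat \<Rightarrow> 'r mat \<Rightarrow> 'r mat" (infixl "\<circ>\<^sub>J" 70)
  where "x \<circ>\<^sub>J y = x * y + y * x"

text \<open>Rows and columns are numbered \<open>0, \<dots>, n - 1\<close>, as always for \<open>'r mat\<close>.\<close>

definition matrix_unit :: "nat \<Rightarrow> nat \<Rightarrow> nat \<Rightarrow> 'r::{zero, one} mat"
  where "matrix_unit n p q = mat n n (\<lambda>(i, j). if i = p \<and> j = q then 1 else 0)"

text \<open>\<open>M\<^sub>n(R)\<^sup>2\<close>: the smallest submodule of \<open>carrier_mat n n\<close> containing all products.\<close>

inductive_set mat_square :: "nat \<Rightarrow> 'r::semiring_0 mat set" for n :: nat
  where
    zero: "0\<^sub>m n n \<in> mat_square n"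
  | prod: "x \<in> carrier_mat n n \<Longrightarrow> y \<in> carrier_mat n n \<Longrightarrow> x * y \<in> mat_square n"
  | add: "u \<in> mat_square n \<Longrightarrow> v \<in> mat_square n \<Longrightarrow> u + v \<in> mat_square n"
  | smult: "u \<in> mat_square n \<Longrightarrow> r \<cdot>\<^sub>m u \<in> mat_square n"

text \<open>Maps defined on a set of matrices are total functions, constrained only on that set.\<close>

definition linear_map_on ::
  "('r::semiring_0 \<Rightarrow> 'x::ab_group_add \<Rightarrow> 'x) \<Rightarrow> 'r mat set \<Rightarrow> ('r mat \<Rightarrow> 'x) \<Rightarrow> bool"
  where "linear_map_on scale S T \<longleftrightarrow>
    (\<forall>u\<in>S. \<forall>v\<in>S. T (u + v) = T u + T v) \<and>
    (\<forall>r. \<forall>u\<in>S. T (r \<cdot>\<^sub>m u) = scale r (T u))"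

definition symmetric_bilinear_map ::
  "('r::semiring_0 \<Rightarrow> 'x::ab_group_add \<Rightarrow> 'x) \<Rightarrow> nat \<Rightarrow> ('r mat \<Rightarrow> 'r mat \<Rightarrow> 'x) \<Rightarrow> bool"
  where "symmetric_bilinear_map scale n b \<longleftrightarrow>
    (\<forall>x\<in>carrier_mat n n. linear_map_on scale (carrier_mat n n) (\<lambda>y. b x y)) \<and>
    (\<forall>y\<in>carrier_mat n n. linear_map_on scale (carrier_mat n n) (\<lambda>x. b x y)) \<and>
    (\<forall>x\<in>carrier_mat n n. \<forall>y\<in>carrier_mat n n. b x y = b y x)"

text \<open>HOL cannot quantify over types inside a definition, so the type carrying the modules \<open>X\<close>
  is a parameter; leaving it a type variable in a theorem quantifies over all modules.\<close>

definition jordan_product_determined_point ::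
  "'x::ab_group_add itself \<Rightarrow> nat \<Rightarrow> 'r::unital_comm_ring mat \<Rightarrow> bool"
  where "jordan_product_determined_point TYPE('x) n A \<longleftrightarrow>
    A \<in> carrier_mat n n \<and>
    (\<forall>(scale :: 'r \<Rightarrow> 'x \<Rightarrow> 'x) b.
      unital_module scale \<longrightarrow> symmetric_bilinear_map scale n b \<longrightarrow>
      ((\<exists>w. \<forall>x\<in>carrier_mat n n. \<forall>y\<in>carrier_mat n n. x \<circ>\<^sub>J y = A \<longrightarrow> b x y = w) \<longleftrightarrow>
       (\<exists>T. linear_map_on scale (mat_square n) T \<and>
          (\<forall>x\<in>carrier_mat n n. \<forall>y\<in>carrier_mat n n. b x y = T (x \<circ>\<^sub>J y)))))"

end

theory Submission
  imports Defs "HOL-Library.Function_Algebras"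
begin

text \<open>
  Subtracting from the given bilinear map the map $(x, y) \mapsto \frac12\{x \circ y, 1\}$ leaves a
  symmetric bilinear map $f$ with $f(1, \cdot) = 0$, and with $f(x, y) = 0$ whenever
  $x \circ y = e_{pq}$, because $e_{pq} \circ \frac12 = e_{pq}$. It remains to see that $f$ vanishes
  on all pairs of matrix units. Perturbing solutions of $x \circ y = e_{pq}$ such as
  $e_{pp} \circ e_{pq}$ or $e_{pm} \circ e_{mq}$ by elements that Jordan-annihilate them gives most
  pairs. The others contain $e_{qp}$ or lie in row $q$ or column $p$; they come from $x = 1 + N$
  with $N^2 = 0$, for which $x \circ y = 2 e_{pq}$ is solved by
  $y = e_{pq} - \frac12 N \circ e_{pq} + \frac12 N e_{pq} N$. Replacing $N$ by $-N$ and $2N$ separates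
  the terms of degrees 1, 2, 3 in $N$, at the cost of dividing by 6.
\<close>

section \<open>Bilinear maps on a span of matrix units\<close>

text \<open>
  The factor 4 in the assumption \<open>f_zero4\<close> avoids halving in \<^typ>\<open>'v\<close>: it amounts to
  replacing \<open>x\<close> and \<open>y\<close> by \<open>2 x\<close> and \<open>2 y\<close> in \<open>x \<circ> y = e p q\<close>.
\<close>

locale jordan_units =
  fixes n p q :: nat
    and prd :: "'v::ab_group_add \<Rightarrow> 'v \<Rightarrow> 'v" (infixl "\<star>" 70)
    and e :: "nat \<Rightarrow> nat \<Rightarrow> 'v"
    and f :: "'v \<Rightarrow> 'v \<Rightarrow> 'x::ab_group_add"
  assumes n3: "n \<ge> 3" and pn: "p < n" and qn: "q < n" and pq: "p \<noteq> q"
    and prd_add_left: "(x + y) \<star> z = x \<star> z + y \<star> z"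
    and prd_add_right: "x \<star> (y + z) = x \<star> y + x \<star> z"
    and prd_assoc: "x \<star> y \<star> z = x \<star> (y \<star> z)"
    and e_mult: "\<lbrakk>i < n; j < n; k < n; l < n\<rbrakk> \<Longrightarrow> e i j \<star> e k l = (if j = k then e i l else 0)"
    and f_add_left: "f (x + y) z = f x z + f y z"
    and f_sym: "f x y = f y x"
    and f_one: "f (\<Sum>i<n. e i i) x = 0"
    and f_zero4: "x \<star> y + y \<star> x = e p q + e p q + e p q + e p q \<Longrightarrow> f x y = 0"
    and cancel2: "(a::'x) + a = 0 \<Longrightarrow> a = 0"
    and cancel3: "(a::'x) + a + a = 0 \<Longrightarrow> a = 0"
begin

abbreviation one :: 'v where "one \<equiv> \<Sum>i<n. e i i"

abbreviation jprd :: "'v \<Rightarrow> 'v \<Rightarrow> 'v" (infixl "\<diamondop>" 70) where "x \<diamondop> y \<equiv> x \<star> y + y \<star> x"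

text \<open>Passing to the opposite product plays the role of transposition and exchanges \<open>p\<close> and \<open>q\<close>.\<close>

lemma opposite: "jordan_units n q p (\<lambda>x y. y \<star> x) (\<lambda>i j. e j i) f"
proof
  show "n \<ge> 3" "q < n" "p < n" "q \<noteq> p" by (use n3 pn qn pq in auto)
  show "f x y = 0" if "y \<star> x + x \<star> y = e p q + e p q + e p q + e p q" for x y
    using f_zero4[of x y] that by (simp add: add.commute)
  show "f x y = f y x" for x y by (rule f_sym)
  show "f (\<Sum>i<n. e i i) x = 0" for x by (rule f_one)
qed (auto simp: prd_add_left prd_add_right prd_assoc e_mult f_add_left intro: cancel2 cancel3)

lemma f_add_right: "f x (y + z) = f x y + f x z"
  by (metis f_add_left f_sym)

lemma prd_zero [simp]: "0 \<star> x = 0" "x \<star> 0 = 0"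
  using prd_add_left[of 0 0 x] prd_add_right[of x 0 0] by simp_all

lemma f_zero [simp]: "f 0 x = 0" "f x 0 = 0"
  using f_add_left[of 0 0 x] f_add_right[of x 0 0] by simp_all

lemma prd_minus [simp]: "(- x) \<star> y = - (x \<star> y)" "x \<star> (- y) = - (x \<star> y)"
  using prd_add_left[of "- x" x y] prd_add_right[of x "- y" y]
  by (simp_all add: eq_neg_iff_add_eq_0)

lemma f_minus [simp]: "f (- x) y = - f x y" "f x (- y) = - f x y"
  using f_add_left[of "- x" x y] f_add_right[of x "- y" y]
  by (simp_all add: eq_neg_iff_add_eq_0)

lemma prd_diff: "(x - y) \<star> z = x \<star> z - y \<star> z" "x \<star> (y - z) = x \<star> y - x \<star> z"
  using prd_add_left[of x "- y" z] prd_add_right[of x y "- z"] by simp_all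

lemma f_diff: "f (x - y) z = f x z - f y z" "f x (y - z) = f x y - f x z"
  using f_add_left[of x "- y" z] f_add_right[of x y "- z"] by simp_all

lemmas prd_simps = prd_add_left prd_add_right prd_diff
lemmas f_simps = f_add_left f_add_right f_diff

lemma prd_sum: "finite S \<Longrightarrow> (\<Sum>i\<in>S. g i) \<star> x = (\<Sum>i\<in>S. g i \<star> x)"
  "finite S \<Longrightarrow> x \<star> (\<Sum>i\<in>S. g i) = (\<Sum>i\<in>S. x \<star> g i)"
  by (induction S rule: finite_induct) (simp_all add: prd_simps)

lemma f_sum: "finite S \<Longrightarrow> f (\<Sum>i\<in>S. g i) x = (\<Sum>i\<in>S. f (g i) x)"
  "finite S \<Longrightarrow> f x (\<Sum>i\<in>S. g i) = (\<Sum>i\<in>S. f x (g i))"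
  by (induction S rule: finite_induct) (simp_all add: f_simps)

lemma one_e [simp]:
  assumes "i < n" "j < n"
  shows "one \<star> e i j = e i j" "e i j \<star> one = e i j"
proof -
  have "one \<star> e i j = (\<Sum>k<n. if k = i then e i j else 0)"
    unfolding prd_sum(1)[OF finite_lessThan] by (rule sum.cong) (use assms in \<open>auto simp: e_mult\<close>)
  then show "one \<star> e i j = e i j" using assms by simp
  have "e i j \<star> one = (\<Sum>k<n. if k = j then e i j else 0)"
    unfolding prd_sum(2)[OF finite_lessThan] by (rule sum.cong) (use assms in \<open>auto simp: e_mult\<close>)
  then show "e i j \<star> one = e i j" using assms by simp
qed

section \<open>Perturbed solutions and square-zero elements\<close>

lemma f_zero1:
  assumes "x \<diamondop> y = e p q"
  shows "f x y = 0"
proof -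
  \<comment> \<open>Doubling both factors multiplies the Jordan product by 4, the form that
    \<open>f_zero4\<close> asks for.\<close>
  have "f (x + x) (y + y) = 0"
    by (rule f_zero4) (simp add: prd_simps assms[symmetric] algebra_simps)
  then have "(f x y + f x y) + (f x y + f x y) = 0" by (simp add: f_simps)
  then show ?thesis using cancel2 by blast
qed

text \<open>The four pairs formed from \<open>x\<close> or \<open>x + z\<close> and \<open>y\<close>
  or \<open>y + w\<close> all have Jordan product \<open>e p q\<close>, so \<open>f\<close> vanishes
  on each. Inclusion-exclusion isolates \<open>f z w\<close>.\<close>

lemma f_perturb:
  assumes "x \<diamondop> y = e p q" "z \<diamondop> y = 0" "x \<diamondop> w = 0" "z \<diamondop> w = 0"
  shows "f z w = 0"
proof -
  have "x \<diamondop> (y + w) = x \<diamondop> y + x \<diamondop> w" "(x + z) \<diamondop> y = x \<diamondop> y + z \<diamondop> y"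
    "(x + z) \<diamondop> (y + w) = x \<diamondop> y + x \<diamondop> w + (z \<diamondop> y + z \<diamondop> w)"
    by (simp_all add: prd_simps add_ac)
  then have "f x y = 0" "f (x + z) y = 0" "f x (y + w) = 0" "f (x + z) (y + w) = 0"
    using assms by (auto intro!: f_zero1)
  then show ?thesis by (simp add: f_simps)
qed

lemma nilpotent:
  assumes NN: "N \<star> N = 0" and N1: "one \<star> N = N" "N \<star> one = N"
  shows "f N (e p q) = 0" "f N (N \<diamondop> e p q) = 0" "f N (N \<star> e p q \<star> N) = 0"
proof -
  \<comment> \<open>The Jordan product with \<open>1 + M\<close> is 2 plus the Jordan product with
    \<open>M\<close>. As \<open>M\<close> squares to zero, the latter kills \<open>e p q\<close>
    after three applications, so the geometric series solving for the second factor stops at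
    \<open>M \<star> e p q \<star> M\<close>.\<close>
  have base: "f M (e p q) + f M (e p q) - f M (M \<diamondop> e p q) + f M (M \<star> e p q \<star> M) = 0"
    if MM: "M \<star> M = 0" and M1: "one \<star> M = M" "M \<star> one = M" for M
  proof -
    have [simp]: "M \<star> (M \<star> x) = 0" for x
      using prd_assoc[of M M x] MM by simp
    have [simp]: "one \<star> (M \<star> x) = M \<star> x" for x
      using prd_assoc[of one M x] M1 by simp
    have [simp]: "one \<star> (e p q \<star> x) = e p q \<star> x" for x
      using prd_assoc[of one "e p q" x] pn qn by simp
    have "f (one + M) (e p q + e p q - M \<diamondop> e p q + M \<star> e p q \<star> M) = 0"
      by (rule f_zero4) (simp add: prd_simps prd_assoc MM M1 pn qn algebra_simps)
    then show ?thesis by (simp add: f_add_left f_one) (simp add: f_simps)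
  qed
  \<comment> \<open>These are homogeneous of degree 1, 2, 3 in \<open>N\<close>. The relations for
    \<open>N\<close> and \<open>- N\<close> give \<open>b = 0\<close> and
    \<open>c = - (a + a)\<close>; the one for \<open>N + N\<close> then says that 12 times
    \<open>a\<close> is zero.\<close>
  define a b c where "a = f N (e p q)" and "b = f N (N \<diamondop> e p q)" and "c = f N (N \<star> e p q \<star> N)"
  have 1: "a + a - b + c = 0"
    using base[OF NN N1] by (simp add: a_def b_def c_def)
  have 2: "- a - a - b - c = 0"
    using base[of "- N"] NN N1 by (simp add: a_def b_def c_def f_simps algebra_simps)
  have 3: "(a + a) + (a + a) - (b + b + b + b) + (c + c + c + c + c + c + c + c) = 0"
    using base[of "N + N"] NN N1 by (simp add: a_def b_def c_def prd_simps f_simps algebra_simps)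
  have "b + b = - ((a + a - b + c) + (- a - a - b - c))" by simp
  then have "b + b = 0" unfolding 1 2 by simp
  then have b: "b = 0" by (rule cancel2)
  have c': "c = - (a + a)" using 1 b minus_unique[of "a + a" c] by simp
  have "(a + a + a) + (a + a + a) + ((a + a + a) + (a + a + a))
    = - ((a + a) + (a + a) - (b + b + b + b) + (c + c + c + c + c + c + c + c))"
    unfolding b c' by (simp add: algebra_simps)
  then have "(a + a + a) + (a + a + a) + ((a + a + a) + (a + a + a)) = 0" unfolding 3 by simp
  then have a: "a = 0" using cancel2 cancel3 by blast
  show "f N (e p q) = 0" "f N (N \<diamondop> e p q) = 0" "f N (N \<star> e p q \<star> N) = 0"
    using a b c' by (simp_all add: a_def b_def c_def)
qed


subsection \<open>Pairs of matrix units\<close>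

lemma f_e_disjoint1:
  assumes "i < n" "j < n" "k < n" "l < n" "j \<noteq> k" "l \<noteq> i"
    and "i \<noteq> q" "j \<noteq> p" "(k, l) \<noteq> (q, p)"
  shows "f (e i j) (e k l) = 0"
proof -
  \<comment> \<open>\<open>e i j\<close> Jordan-annihilates \<open>e p q\<close>, so
    \<open>f_perturb\<close> applies as soon as \<open>e k l\<close> misses \<open>e p p\<close> or
    \<open>e q q\<close>. Apart from the excluded \<open>e q p\<close>, only \<open>e p q\<close>
    itself meets both.\<close>
  consider "k \<noteq> p" "l \<noteq> p" | "k \<noteq> q" "l \<noteq> q" | "k = p" "l = q"
    using assms pq by blast
  then show ?thesis
  proof cases
    case 1
    show ?thesis
      by (rule f_perturb[of "e p p" "e p q"]) (use 1 assms pn qn pq in \<open>auto simp: e_mult\<close>)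
  next
    case 2
    show ?thesis
      by (rule f_perturb[of "e q q" "e p q"]) (use 2 assms pn qn pq in \<open>auto simp: e_mult\<close>)
  next
    case 3
    have "f (one + e i j) (e p q + e p q) = 0"
      by (rule f_zero4) (use 3 assms pn qn in \<open>auto simp: prd_simps e_mult\<close>)
    then have "f (e i j) (e k l) + f (e i j) (e k l) = 0" using 3 by (simp add: f_simps f_one)
    then show ?thesis by (rule cancel2)
  qed
qed

lemma ex_third: "\<exists>m<n. m \<noteq> p \<and> m \<noteq> q"
proof -
  have "card {p, q} < card {..<n}" using n3 pq by simp
  then have "\<not> {..<n} \<subseteq> {p, q}" by (metis card_mono finite.emptyI finite.insertI leD)
  then show ?thesis by blast
qed

text \<open>Both units can be composed with \<open>e p q\<close>, which rules out perturbing
  \<open>e p p\<close> and \<open>e p q\<close>. Factoring \<open>e p q\<close> through a third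
  index \<open>m\<close> avoids both.\<close>

lemma f_e_disjoint2:
  assumes "i < n" "l < n" "l \<noteq> i" "i \<noteq> q" "l \<noteq> p"
  shows "f (e i p) (e q l) = 0"
proof -
  obtain m where "m < n" "m \<noteq> p" "m \<noteq> q" using ex_third by blast
  then show ?thesis
    by (intro f_perturb[of "e p m" "e m q"]) (use assms pn qn pq in \<open>auto simp: e_mult\<close>)
qed

text \<open>For suitable \<open>u\<close> in column \<open>p\<close>, \<open>N = e q p + u\<close>
  squares to zero and \<open>N \<star> e p q \<star> N = N\<close>, so the cubic part of
  \<open>nilpotent\<close> reads \<open>f N N = 0\<close>. Polarising over the choices of
  \<open>u\<close> gives all pairs.\<close>

lemma f_e_column:
  assumes "i < n" "k < n" "i \<noteq> p" "k \<noteq> p"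
  shows "f (e i p) (e k p) = 0"
proof -
  have sq: "f (e q p + u) (e q p + u) = 0"
    if u: "u \<star> u = 0" "one \<star> u = u" "u \<star> one = u" "e q p \<star> u = 0" "u \<star> e q p = 0"
      "(e q p + u) \<star> e p q \<star> (e q p + u) = e q p + u" for u
  proof -
    have "(e q p + u) \<star> (e q p + u) = 0" "one \<star> (e q p + u) = e q p + u"
      "(e q p + u) \<star> one = e q p + u"
      using u pq pn qn by (simp_all add: prd_simps e_mult)
    from nilpotent(3)[OF this] show ?thesis unfolding u(6) .
  qed
  have qq: "f (e q p) (e q p) = 0"
    using sq[of 0] pn qn by (simp add: e_mult)
  have sq1: "f (e q p) (e i p) = 0 \<and> f (e i p) (e i p) = 0"
    if "i < n" "i \<noteq> p" "i \<noteq> q" for i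
  proof -
    \<comment> \<open>The two signs separate the mixed term from the square.\<close>
    have 1: "f (e q p + e i p) (e q p + e i p) = 0" "f (e q p + - e i p) (e q p + - e i p) = 0"
      by (rule sq; use that pn qn pq in \<open>simp add: prd_simps e_mult\<close>)+
    define a b where "a = f (e q p) (e i p)" and "b = f (e i p) (e i p)"
    have 2: "a + a + b = 0" "- a - a + b = 0"
      using 1 qq by (simp_all add: f_simps f_sym[of "e i p" "e q p"] a_def b_def algebra_simps)
    have "b + b = (a + a + b) + (- a - a + b)" by simp
    then have "b + b = 0" unfolding 2 by simp
    then have "b = 0" by (rule cancel2)
    then show ?thesis using 2 cancel2[of a] by (simp add: a_def b_def)
  qed
  show ?thesis
  proof (cases "i = q \<or> k = q \<or> i = k")
    case True
    then show ?thesis using qq sq1 assms f_sym by metis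
  next
    case False
    have "f (e q p + (e i p + e k p)) (e q p + (e i p + e k p)) = 0"
      by (rule sq; use False assms pn qn pq in \<open>simp add: prd_simps e_mult\<close>)
    then have "f (e i p) (e k p) + f (e i p) (e k p) = 0"
      using sq1[of i] sq1[of k] qq False assms
      by (simp add: f_simps f_sym[of "e i p" "e q p"] f_sym[of "e k p" "e q p"] f_sym[of "e k p" "e i p"])
    then show ?thesis by (rule cancel2)
  qed
qed

lemma f_e_row:
  assumes "j < n" "l < n" "j \<noteq> q" "l \<noteq> q"
  shows "f (e q j) (e q l) = 0"
  using jordan_units.f_e_column[OF opposite] assms by blast

lemma f_e_qp_other:
  assumes "i < n" "j < n" "i \<noteq> p" "i \<noteq> q" "j \<noteq> p" "j \<noteq> q"
  shows "f (e q p) (e i j) = 0"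
proof -
  \<comment> \<open>Solve with \<open>x = 1 + N\<close>, \<open>N = e q p\<close> or \<open>- e q p\<close>, in the corner cut out by \<open>1 - d\<close>, where \<open>e i j\<close>
    may be added to \<open>y\<close> freely.\<close>
  define d where "d = (if i = j then e i i else e i i + e j j)"
  have d: "d \<star> e p p = 0" "d \<star> e q q = 0" "d \<star> e p q = 0" "d \<star> e q p = 0"
    "e p p \<star> d = 0" "e q q \<star> d = 0" "e p q \<star> d = 0" "e q p \<star> d = 0"
    "d \<star> e i j = e i j" "e i j \<star> d = e i j"
    using assms pn qn by (auto simp: d_def prd_simps e_mult)
  have "f (one - d + e q p) (e p q + e p q - e p p - e q q + e q p) = 0"
      "f (one - d + e q p) (e p q + e p q - e p p - e q q + e q p + e i j) = 0"
      "f (one - d - e q p) (e p q + e p q + e p p + e q q + e q p) = 0"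
      "f (one - d - e q p) (e p q + e p q + e p p + e q q + e q p + e i j) = 0"
    by (rule f_zero4; use assms pn qn pq in \<open>simp add: prd_simps e_mult d algebra_simps\<close>)+
  then have "f (one - d + e q p) (e i j) = 0" "f (one - d - e q p) (e i j) = 0"
    by (metis add_0 f_add_right)+
  moreover have "f (e q p) (e i j) + f (e q p) (e i j)
      = f (one - d + e q p) (e i j) - f (one - d - e q p) (e i j)"
    by (simp add: f_simps)
  ultimately have "f (e q p) (e i j) + f (e q p) (e i j) = 0" by simp
  then show ?thesis by (rule cancel2)
qed

text \<open>A unit outside row \<open>q\<close> and column \<open>p\<close> Jordan-annihilates
  \<open>e p q\<close>, and \<open>half\<close> settles every pair containing one. Otherwise both
  units lie in row \<open>q\<close>, both in column \<open>p\<close>, or one in each.\<close>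

lemma f_e_disjoint:
  assumes "i < n" "j < n" "k < n" "l < n" "j \<noteq> k" "l \<noteq> i"
  shows "f (e i j) (e k l) = 0"
proof -
  have half: "f (e i j) (e k l) = 0"
    if "i < n" "j < n" "k < n" "l < n" "j \<noteq> k" "l \<noteq> i" "i \<noteq> q" "j \<noteq> p" for i j k l
  proof (cases "k = q \<and> l = p")
    case True
    then show ?thesis using that f_e_qp_other[of i j] f_sym[of "e q p"] by simp
  next
    case False
    then show ?thesis using that by (intro f_e_disjoint1) auto
  qed
  consider "i \<noteq> q \<and> j \<noteq> p" | "k \<noteq> q \<and> l \<noteq> p" | "i = q" "k = q" | "j = p" "l = p"
    | "i \<noteq> q" "j = p" "k = q" "l \<noteq> p" | "k \<noteq> q" "l = p" "i = q" "j \<noteq> p"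
    by blast
  then show ?thesis
  proof cases
    case 1
    then show ?thesis using half assms by simp
  next
    case 2
    then show ?thesis using half[of k l i j] assms f_sym by simp
  next
    case 3
    then show ?thesis using f_e_row assms by simp
  next
    case 4
    then show ?thesis using f_e_column assms by simp
  next
    case 5
    then show ?thesis using f_e_disjoint2 assms by simp
  next
    case 6
    then show ?thesis using f_e_disjoint2[of k j] assms f_sym[of "e i j"] by simp
  qed
qed


section \<open>Composable pairs of units with different outer indices\<close>

lemma f_e_ends:
  assumes "i < n" "l < n" "i \<noteq> l"
  shows "f (e i i) (e i l) + f (e l l) (e i l) = 0"
proof -
  \<comment> \<open>Expand the unit in \<open>f_one\<close>: every \<open>e k k\<close> with
    \<open>k\<close> not an end of \<open>e i l\<close> is disjoint from it.\<close>
  have "0 = (\<Sum>k<n. f (e k k) (e i l))"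
    using f_one[of "e i l"] by (simp add: f_sum)
  also have "\<dots> = (\<Sum>k\<in>{i, l}. f (e k k) (e i l))"
    by (rule sum.mono_neutral_right) (use assms in \<open>auto intro: f_e_disjoint\<close>)
  finally show ?thesis using assms by simp
qed

text \<open>The signs make the two path products cancel, so the sum and the difference
  Jordan-annihilate each other; the cross terms vanish by disjointness. Hence the middle index does
  not matter.\<close>

lemma f_e_path_eq:
  assumes "i < n" "j < n" "k < n" "l < n" "i \<noteq> l" "i \<noteq> q" "l \<noteq> p" "j \<noteq> p" "k \<noteq> p"
  shows "f (e i j) (e j l) = f (e i k) (e k l)"
proof (cases "j = k")
  case False
  have "f (e i j + e i k) (e j l - e k l) = 0"
    by (rule f_perturb[of "e p p" "e p q"])
      (use False assms pn qn pq in \<open>auto simp: prd_simps e_mult\<close>)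
  then show ?thesis using False assms by (simp add: f_simps f_e_disjoint)
qed simp

text \<open>The middle index \<open>p\<close>, barred in \<open>f_e_path_eq\<close>, is reached
  through the opposite product. So the choices \<open>j = i\<close> and \<open>j = l\<close> give
  equal values, while \<open>f_e_ends\<close> makes their sum zero.\<close>

lemma f_e_path1:
  assumes "i < n" "j < n" "l < n" "i \<noteq> l" "i \<noteq> q" "l \<noteq> p"
  shows "f (e i j) (e j l) = 0"
proof -
  obtain m where m: "m < n" "m \<noteq> p" "m \<noteq> q" using ex_third by blast
  have *: "f (e i j) (e j l) = f (e i m) (e m l)" if "j < n" for j
  proof (cases "j = p")
    case True
    then show ?thesis
      using jordan_units.f_e_path_eq[OF opposite, of l j m i] that m assms pq
        f_sym[of "e j l" "e i j"] f_sym[of "e m l" "e i m"] by simp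
  next
    case False
    then show ?thesis using f_e_path_eq[of i j m l] that m assms by simp
  qed
  have "f (e i m) (e m l) + f (e i m) (e m l) = 0"
    using f_e_ends[of i l] *[of i] *[of l] assms f_sym[of "e l l" "e i l"] by simp
  then show ?thesis using *[OF assms(2)] cancel2[of "f (e i m) (e m l)"] by simp
qed

lemma f_e_path2:
  assumes "j < n" "l < n" "l \<noteq> p" "l \<noteq> q"
  shows "f (e q j) (e j l) = 0"
proof -
  \<comment> \<open>In this solution the terms in \<open>e p l\<close> and \<open>e q l\<close> from
    the two orders cancel. It equates the two end values, whose sum is zero by
    \<open>f_e_ends\<close>.\<close>
  have "f (e p p + e q l) (e p q - e p l + e q q - e l l) = 0"
    by (rule f_zero1) (use assms pn qn pq in \<open>simp add: prd_simps e_mult\<close>)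
  then have "f (e q l) (e q q) = f (e q l) (e l l)"
    using assms pn qn pq f_e_path1[of p p q] f_e_path1[of p p l] f_e_path1[of p q l]
    by (simp add: f_simps f_e_disjoint f_sym[of "e q l" "e p q"])
  moreover have "f (e q l) (e q q) + f (e q l) (e l l) = 0"
    using f_e_ends[of q l] assms qn f_sym[of "e q q" "e q l"] f_sym[of "e l l" "e q l"] by simp
  ultimately have ends: "f (e q l) (e q q) = 0" "f (e q l) (e l l) = 0"
    using cancel2[of "f (e q l) (e l l)"] by simp_all
  consider "j = q" | "j = l" | "j = p" | "j \<noteq> q" "j \<noteq> l" "j \<noteq> p" by blast
  then show ?thesis
  proof cases
    case 1
    then show ?thesis using ends f_sym[of "e q q" "e q l"] by simp
  next
    case 2
    then show ?thesis using ends by simp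
  next
    case 3
    \<comment> \<open>The Jordan products of \<open>e q p\<close> and of
      \<open>e q l + e q p\<close> with \<open>e p q\<close> differ by \<open>e p l\<close>.
      Comparing the two quadratic relations isolates \<open>f (e q p) (e p l)\<close>.\<close>
    have "f (e q p) (e q p \<diamondop> e p q) = 0"
      by (rule nilpotent(2)) (use pn qn pq in \<open>auto simp: e_mult\<close>)
    then have qp: "f (e q p) (e q q) + f (e q p) (e p p) = 0"
      using pn qn by (simp add: e_mult f_simps)
    have "f (e q l + e q p) ((e q l + e q p) \<diamondop> e p q) = 0"
      by (rule nilpotent(2)) (use assms pn qn pq in \<open>auto simp: prd_simps e_mult\<close>)
    then have "f (e q p) (e p l) + (f (e q p) (e q q) + f (e q p) (e p p)) = 0"
      using assms pn qn pq by (simp add: prd_simps e_mult f_simps f_e_disjoint ends add_ac)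
    then show ?thesis using 3 qp by simp
  next
    case 4
    \<comment> \<open>On the left of \<open>e j l - e l l\<close>, the sum
      \<open>e q j + e q l\<close> gives zero; \<open>- e p j - e p l\<close> offsets its product
      with \<open>e p q\<close>. The wanted value is the only one not yet known.\<close>
    have "f (e p p + (e q j + e q l)) (e p q + (e j l - e l l - e p j - e p l)) = 0"
      by (rule f_zero1) (use 4 assms pn qn pq in \<open>simp add: prd_simps e_mult\<close>)
    then show ?thesis
      using 4 assms pn qn pq f_e_path1[of p p q] f_e_path1[of p p l] f_e_path1[of p p j]
        f_e_path1[of p q l] f_e_path1[of p q j]
      by (simp add: f_simps f_e_disjoint ends f_sym[of "e q l" "e p q"] f_sym[of "e q j" "e p q"])
  qed
qed

lemma f_e_path3:
  assumes "i < n" "j < n" "i \<noteq> p" "i \<noteq> q"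
  shows "f (e i j) (e j p) = 0"
  using jordan_units.f_e_path2[OF opposite, of j i] assms f_sym[of "e i j" "e j p"] by simp

lemma f_e_diag:
  assumes "i < n"
  shows "f (e i i) (e i i) = 0"
proof -
  have "0 = (\<Sum>k<n. f (e k k) (e i i))"
    using f_one[of "e i i"] by (simp add: f_sum)
  also have "\<dots> = (\<Sum>k\<in>{i}. f (e k k) (e i i))"
    by (rule sum.mono_neutral_right) (use assms in \<open>auto intro: f_e_disjoint\<close>)
  finally show ?thesis by simp
qed

lemma f_e_through_third:
  assumes "i < n" "i \<noteq> p" "i \<noteq> q"
  shows "f (e q i) (e i p) = f (e q p) (e p p)" "f (e i p) (e p i) = 0"
proof -
  \<comment> \<open>The nilpotents are \<open>N = u v\<^sup>T\<close> with \<open>u = e\<^sub>q + e\<^sub>i - t e\<^sub>p\<close>, \<open>v = e\<^sub>p + t e\<^sub>i\<close> for \<open>t = 1\<close> and \<open>t = - 1\<close>;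
    \<open>N (e p q) N = N\<close>.\<close>
  define B C where "B = f (e q i) (e i p) - f (e q p) (e p p)" and "C = f (e i p) (e p i)"
  have sq: "f N N = 0" if "N \<star> N = 0" "one \<star> N = N" "N \<star> one = N" "N \<star> e p q \<star> N = N" for N
    using nilpotent(3)[OF that(1-3)] that(4) by simp
  have 1: "f (e q p + e q i + e i p + e i i - e p p - e p i)
      (e q p + e q i + e i p + e i i - e p p - e p i) = 0"
    by (rule sq) (use assms pn qn pq in \<open>simp_all add: prd_simps e_mult\<close>)
  have 2: "f (e q p - e q i + e i p - e i i + e p p - e p i)
      (e q p - e q i + e i p - e i i + e p p - e p i) = 0"
    by (rule sq) (use assms pn qn pq in \<open>simp_all add: prd_simps e_mult\<close>)
  have z: "f (e q p) (e p i) = 0" "f (e q i) (e i i) = 0" "f (e i i) (e i p) = 0"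
      "f (e i p) (e p p) = 0" "f (e p i) (e i i) = 0" "f (e p p) (e p i) = 0"
      "f (e i i) (e i i) = 0" "f (e p p) (e p p) = 0"
    using assms pn qn pq by (simp_all add: f_e_path1 f_e_path2 f_e_path3 f_e_diag)
  have z': "f (e p i) (e q p) = 0" "f (e i i) (e q i) = 0" "f (e i p) (e i i) = 0"
      "f (e p p) (e i p) = 0" "f (e i i) (e p i) = 0" "f (e p i) (e p p) = 0"
    using z f_sym by metis+
  have s: "f (e i p) (e q i) = f (e q i) (e i p)" "f (e p p) (e q p) = f (e q p) (e p p)"
    "f (e p i) (e i p) = f (e i p) (e p i)"
    by (rule f_sym)+
  \<comment> \<open>Only \<open>B\<close> and \<open>C\<close> survive in \<open>f N N\<close>;
    changing the sign of \<open>t\<close> flips \<open>B\<close> relative to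
    \<open>C\<close>.\<close>
  have 1: "(B - C) + (B - C) = 0" 
    using 1 assms pn qn pq by (simp add: f_simps f_e_disjoint z z' s B_def C_def algebra_simps)
  have 2: "(B + C) + (B + C) = 0" 
    using 2 assms pn qn pq by (simp add: f_simps f_e_disjoint z z' s B_def C_def algebra_simps)
  have BC: "B = C" "B + C = 0" using cancel2[OF 1] cancel2[OF 2] by simp_all
  then have "C = 0" using cancel2[of C] by simp
  with BC show "f (e q i) (e i p) = f (e q p) (e p p)" "f (e i p) (e p i) = 0"
    by (simp_all add: B_def C_def)
qed

text \<open>Only paths from \<open>q\<close> to \<open>p\<close> remain.
  \<open>f_e_through_third\<close> and its opposite equate both end values with the value through a
  third index, and by \<open>f_e_ends\<close> the end values add up to zero.\<close>

lemma f_e_path: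
  assumes "i < n" "j < n" "l < n" "i \<noteq> l"
  shows "f (e i j) (e j l) = 0"
proof -
  obtain m where m: "m < n" "m \<noteq> p" "m \<noteq> q" using ex_third by blast
  have third: "f (e q j) (e j p) = f (e q p) (e p p)" "f (e q j) (e j p) = f (e q q) (e q p)"
    if "j < n" "j \<noteq> p" "j \<noteq> q" for j
    using that f_e_through_third(1)[of j] jordan_units.f_e_through_third(1)[OF opposite, of j]
      f_sym[of "e j p" "e q j"] f_sym[of "e q p" "e q q"] by simp_all
  have eq: "f (e q q) (e q p) = f (e q p) (e p p)"
    using third[OF m] by simp
  have "f (e q q) (e q p) + f (e p p) (e q p) = 0"
    using f_e_ends[of q p] pn qn pq by simp
  then have "f (e q p) (e p p) = 0"
    using eq f_sym[of "e p p" "e q p"] cancel2[of "f (e q p) (e p p)"] by simp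
  then have qp: "f (e q j) (e j p) = 0" if "j < n" for j
    using that eq third[of j] by (cases "j = p \<or> j = q") auto
  consider "i \<noteq> q" "l \<noteq> p" | "i = q" "l \<noteq> p" | "i \<noteq> q" "l = p" | "i = q" "l = p" by blast
  then show ?thesis
    by cases (use assms qp f_e_path1 f_e_path2 f_e_path3 in auto)
qed

section \<open>Opposite pairs of units, and vanishing on all pairs\<close>

lemma f_e_opposite:
  assumes "i < n" "j < n" "i \<noteq> j"
  shows "f (e i j) (e j i) = 0"
proof -
  have qp: "f (e q p) (e p q) = 0"
    by (rule nilpotent(1)) (use pn qn pq in \<open>auto simp: e_mult\<close>)
  have p: "f (e i p) (e p i) = 0" "f (e p i) (e i p) = 0" if "i < n" "i \<noteq> p" for i
    using that f_e_through_third(2)[of i] qp f_sym[of "e p i" "e i p"] by (cases "i = q"; simp)+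
  have q: "f (e q i) (e i q) = 0" "f (e i q) (e q i) = 0" if "i < n" "i \<noteq> q" for i
    using that jordan_units.f_e_through_third(2)[OF opposite, of i] qp f_sym[of "e p q" "e q p"]
      f_sym[of "e q i" "e i q"] by (cases "i = p"; simp)+
  show ?thesis
  proof (cases "i = p \<or> j = p \<or> i = q \<or> j = q")
    case True
    then show ?thesis using p q assms by auto
  next
    case False
    \<comment> \<open>This is the square-zero block with rows (1, 1) and (-1, -1) on the indices
      \<open>i\<close>, \<open>j\<close>. It avoids \<open>p\<close> and \<open>q\<close>, so it may
      perturb both factors at once.\<close>
    have "f (e i i - e j j + e i j - e j i) (e i i - e j j + e i j - e j i) = 0"
      by (rule f_perturb[of "e p p" "e p q"])
        (use False assms pn qn pq in \<open>auto simp: prd_simps e_mult\<close>)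
    moreover have "f (e i i - e j j + e i j - e j i) (e i i - e j j + e i j - e j i)
        = - (f (e i j) (e j i) + f (e i j) (e j i))"
      using assms f_e_path[of i i j] f_e_path[of i j j] f_e_path[of j i i] f_e_path[of j j i]
        f_sym[of "e j i" "e i j"] f_sym[of "e i j" "e i i"] f_sym[of "e j j" "e i j"]
        f_sym[of "e i i" "e j i"] f_sym[of "e j i" "e j j"]
      by (simp add: f_simps f_e_disjoint f_e_diag algebra_simps)
    ultimately have "f (e i j) (e j i) + f (e i j) (e j i) = 0"
      by (simp only: neg_equal_0_iff_equal)
    then show ?thesis by (rule cancel2)
  qed
qed

lemma f_e_eq_0:
  assumes "i < n" "j < n" "k < n" "l < n"
  shows "f (e i j) (e k l) = 0"
proof -
  consider "j \<noteq> k" "l \<noteq> i" | "j = k" "i \<noteq> l" | "j \<noteq> k" "i = l" | "j = k" "i = l" "i \<noteq> j"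
    | "j = k" "i = l" "i = j" by blast
  then show ?thesis
    by cases (use assms f_e_disjoint f_e_path f_e_path[of k i j] f_sym[of "e i j" "e k l"]
      f_e_opposite f_e_diag in auto)
qed

end

section \<open>Matrices as functions on pairs of indices\<close>

text \<open>Matrices of the type \<open>'r mat\<close> do not form a group because their dimensions vary; functions on
  pairs of indices do.\<close>

definition fun_unit :: "nat \<Rightarrow> nat \<Rightarrow> nat \<times> nat \<Rightarrow> 'r::{zero, one}"
  where "fun_unit i j = (\<lambda>(a, b). if a = i \<and> b = j then 1 else 0)"

definition fun_prod :: "nat \<Rightarrow> (nat \<times> nat \<Rightarrow> 'r::semiring_0) \<Rightarrow> (nat \<times> nat \<Rightarrow> 'r) \<Rightarrow> nat \<times> nat \<Rightarrow> 'r"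
  where "fun_prod n g h = (\<lambda>(a, b). \<Sum>k<n. g (a, k) * h (k, b))"

lemma mat_add_fun: "mat n n (g + h) = mat n n g + mat n n (h :: nat \<times> nat \<Rightarrow> 'r::semigroup_add)"
  by (rule eq_matI) auto

lemma mat_smult_fun: "mat n n (\<lambda>z. c * g z) = c \<cdot>\<^sub>m mat n n g"
  by (rule eq_matI) auto

lemma mat_fun_prod: "mat n n (fun_prod n g h) = mat n n g * mat n n h"
  by (rule eq_matI) (auto simp: fun_prod_def scalar_prod_def atLeast0LessThan)

lemma mat_fun_unit: "mat n n (fun_unit p q) = matrix_unit n p q"
  by (simp add: fun_unit_def matrix_unit_def)

lemma sum_fun_apply: "(\<Sum>i\<in>S. g i) x = (\<Sum>i\<in>S. g i x)"
  by (induction S rule: infinite_finite_induct) auto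

lemma fun_unit_sum: "(\<Sum>i<n. fun_unit i i) (a, b) = (if a = b \<and> a < n then 1 else (0::'r::unital_comm_ring))"
proof -
  have "(\<Sum>i<n. fun_unit i i) (a, b) = (\<Sum>i<n. if i = a then (if a = b then 1 else 0) else (0::'r))"
    unfolding sum_fun_apply by (rule sum.cong) (auto simp: fun_unit_def)
  then show ?thesis by simp
qed

lemma mat_fun_unit_sum_mult:
  fixes x :: "'r::unital_comm_ring mat"
  assumes "x \<in> carrier_mat n n"
  shows "mat n n (\<Sum>i<n. fun_unit i i) * x = x" "x * mat n n (\<Sum>i<n. fun_unit i i) = x"
proof -
  have 1: "(\<Sum>k<n. (if a = k \<and> a < n then 1 else 0) * x $$ (k, b)) = x $$ (a, b)" if "a < n" for a b
  proof -
    have "(\<Sum>k<n. (if a = k \<and> a < n then 1 else 0) * x $$ (k, b))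
        = (\<Sum>k<n. if k = a then x $$ (a, b) else 0)"
      by (rule sum.cong) (use that in auto)
    then show ?thesis using that by simp
  qed
  have 2: "(\<Sum>k<n. x $$ (a, k) * (if k = b \<and> k < n then 1 else 0)) = x $$ (a, b)" if "b < n" for a b
  proof -
    have "(\<Sum>k<n. x $$ (a, k) * (if k = b \<and> k < n then 1 else 0))
        = (\<Sum>k<n. if k = b then x $$ (a, b) else 0)"
      by (rule sum.cong) (use that in auto)
    then show ?thesis using that by simp
  qed
  show "mat n n (\<Sum>i<n. fun_unit i i) * x = x" "x * mat n n (\<Sum>i<n. fun_unit i i) = x"
    by (rule eq_matI; use assms 1 2 in \<open>simp add: scalar_prod_def atLeast0LessThan fun_unit_sum\<close>)+
qed

lemma fun_prod_unit:
  assumes "j < n"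
  shows "fun_prod n (fun_unit i j) (fun_unit k l)
    = (if j = k then fun_unit i l else (0 :: nat \<times> nat \<Rightarrow> 'r::unital_comm_ring))"
proof
  fix z :: "nat \<times> nat"
  obtain a b where z: "z = (a, b)" by fastforce
  have "fun_prod n (fun_unit i j) (fun_unit k l) z
      = (\<Sum>m<n. if m = j then (if j = k \<and> a = i \<and> b = l then 1 else 0) else (0::'r))"
    unfolding fun_prod_def z prod.case by (rule sum.cong) (auto simp: fun_unit_def)
  then show "fun_prod n (fun_unit i j) (fun_unit k l) z
      = (if j = k then fun_unit i l else (0 :: nat \<times> nat \<Rightarrow> 'r)) z"
    using assms by (auto simp: fun_unit_def z)
qed

lemma fun_prod_assoc:
  "fun_prod n (fun_prod n g h) k = fun_prod n g (fun_prod n h k)"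
proof
  fix z :: "nat \<times> nat"
  obtain a b where z: "z = (a, b)" by fastforce
  have "(\<Sum>m<n. (\<Sum>l<n. g (a, l) * h (l, m)) * k (m, b))
      = (\<Sum>m<n. \<Sum>l<n. g (a, l) * (h (l, m) * k (m, b)))"
    by (simp add: sum_distrib_right mult.assoc)
  also have "\<dots> = (\<Sum>l<n. \<Sum>m<n. g (a, l) * (h (l, m) * k (m, b)))"
    by (rule sum.swap)
  finally show "fun_prod n (fun_prod n g h) k z = fun_prod n g (fun_prod n h k) z"
    by (simp add: fun_prod_def z sum_distrib_left)
qed

lemma mat_square_subset: "mat_square n \<subseteq> carrier_mat n n"
proof
  fix z :: "'a mat" assume "z \<in> mat_square n"
  then show "z \<in> carrier_mat n n" by induction auto
qed

section \<open>Subtracting the part that factors through the Jordan product\<close>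

context
  fixes scale :: "'r::unital_comm_ring \<Rightarrow> 'x::ab_group_add \<Rightarrow> 'x"
    and n :: nat and b :: "'r mat \<Rightarrow> 'r mat \<Rightarrow> 'x" and c :: 'r
  assumes module: "unital_module scale"
    and sb: "symmetric_bilinear_map scale n b"
    and c: "6 * c = 1"
begin

interpretation unital_module scale by (rule module)

lemma scale_zero: "scale a 0 = 0"
  using scale_right_distrib[of a 0 0] by simp

lemma scale_diff: "scale a (x - y) = scale a x - scale a y"
  using scale_right_distrib[of a "x - y" y] by (simp add: algebra_simps)

text \<open>With \<open>c\<close> an inverse of 6, \<open>3 * c\<close> serves as one half and
  \<open>2 * c\<close> as one third.\<close>

lemma c_half: "3 * c + 3 * c = 1"
proof -
  have "3 * c + 3 * c = (3 + 3) * c" by (simp only: distrib_right)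
  then show ?thesis using c by simp
qed

lemma c_third: "2 * c + 2 * c + 2 * c = 1"
proof -
  have "2 * c + 2 * c + 2 * c = (2 + 2 + 2) * c" by (simp only: distrib_right)
  then show ?thesis using c by simp
qed

lemma scale_half: "scale (3 * c) x + scale (3 * c) x = x"
  using scale_left_distrib[of "3 * c" "3 * c" x] by (simp add: c_half scale_one)

lemma scale_third: "scale (2 * c) x + scale (2 * c) x + scale (2 * c) x = x"
  using c_third by (metis scale_left_distrib scale_one)

lemma b_simps:
  assumes "x \<in> carrier_mat n n" "y \<in> carrier_mat n n" "z \<in> carrier_mat n n"
  shows "b (x + y) z = b x z + b y z" "b z (x + y) = b z x + b z y"
    "b (r \<cdot>\<^sub>m x) z = scale r (b x z)" "b z (r \<cdot>\<^sub>m x) = scale r (b z x)"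
  using sb assms unfolding symmetric_bilinear_map_def linear_map_on_def by auto

lemma b_sym: "x \<in> carrier_mat n n \<Longrightarrow> y \<in> carrier_mat n n \<Longrightarrow> b x y = b y x"
  using sb unfolding symmetric_bilinear_map_def by auto

text \<open>The identity matrix, written as the image of the unit \<open>one\<close> of
  \<open>jordan_units\<close> to match \<open>f_one\<close>.\<close>

definition unit_mat :: "'r mat" where "unit_mat = mat n n (\<Sum>i<n. fun_unit i i)"

text \<open>This becomes the map \<open>T\<close> of condition (ii).\<close>

definition jmap :: "'r mat \<Rightarrow> 'x" where "jmap z = scale (3 * c) (b z unit_mat)"

text \<open>This is the \<open>f\<close> of \<open>jordan_units\<close>. It sees only entries with
  both indices below \<open>n\<close>.\<close>

definition defect :: "(nat \<times> nat \<Rightarrow> 'r) \<Rightarrow> (nat \<times> nat \<Rightarrow> 'r) \<Rightarrow> 'x"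
  where "defect g h = b (mat n n g) (mat n n h) - jmap (mat n n g \<circ>\<^sub>J mat n n h)"

lemma unit_mat_carrier [simp]: "unit_mat \<in> carrier_mat n n"
  by (simp add: unit_mat_def)

lemma unit_mat_mult [simp]:
  assumes "x \<in> carrier_mat n n"
  shows "unit_mat * x = x" "x * unit_mat = x"
  using mat_fun_unit_sum_mult[OF assms] by (simp_all add: unit_mat_def)

lemma jmap_add: "x \<in> carrier_mat n n \<Longrightarrow> y \<in> carrier_mat n n \<Longrightarrow> jmap (x + y) = jmap x + jmap y"
  by (simp add: jmap_def b_simps scale_right_distrib)

lemma jmap_smult: "x \<in> carrier_mat n n \<Longrightarrow> jmap (r \<cdot>\<^sub>m x) = scale r (jmap x)"
  by (simp add: jmap_def b_simps[of x x] scale_scale mult.commute)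

lemma jordan_carrier [simp]:
  "x \<in> carrier_mat n n \<Longrightarrow> y \<in> carrier_mat n n \<Longrightarrow> x \<circ>\<^sub>J y \<in> carrier_mat n n"
  by (auto simp: jordan_prod_def)

lemma jordan_add:
  fixes x y z :: "'r mat"
  assumes "x \<in> carrier_mat n n" "y \<in> carrier_mat n n" "z \<in> carrier_mat n n"
  shows "(x + y) \<circ>\<^sub>J z = x \<circ>\<^sub>J z + y \<circ>\<^sub>J z"
proof -
  have "x * z + y * z + (z * x + z * y) = x * z + z * x + (y * z + z * y)"
    by (rule eq_matI) (use assms in \<open>auto simp: algebra_simps\<close>)
  then show ?thesis
    using assms by (simp add: jordan_prod_def add_mult_distrib_mat[of _ n n] mult_add_distrib_mat[of _ n n])
qed

lemma jordan_smult:
  fixes x z :: "'r mat"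
  assumes "x \<in> carrier_mat n n" "z \<in> carrier_mat n n"
  shows "(r \<cdot>\<^sub>m x) \<circ>\<^sub>J z = r \<cdot>\<^sub>m (x \<circ>\<^sub>J z)"
  using assms by (simp add: jordan_prod_def add_smult_distrib_left_mat[of _ n n]
    mult_smult_assoc_mat[of _ n n] mult_smult_distrib[of _ n n])

lemma jordan_commute: 
  fixes x z :: "'r mat"
  assumes "x \<in> carrier_mat n n" "z \<in> carrier_mat n n"
  shows "x \<circ>\<^sub>J z = z \<circ>\<^sub>J x"
  using assms by (auto simp: jordan_prod_def comm_add_mat[of _ n n])

lemma defect_sym: "defect g h = defect h g"
  by (simp add: defect_def b_sym[of "mat n n g"] jordan_commute[of "mat n n g"])

lemma defect_add: "defect (g + g') h = defect g h + defect g' h"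
  by (simp add: defect_def mat_add_fun b_simps jordan_add jmap_add)

lemma defect_smult: "defect (\<lambda>z. r * g z) h = scale r (defect g h)"
  by (simp add: defect_def mat_smult_fun b_simps[of "mat n n g" "mat n n g"] jordan_smult jmap_smult scale_diff)

lemma defect_one: "defect (\<Sum>i<n. fun_unit i i) h = 0"
  by (simp add: defect_def unit_mat_def[symmetric] jordan_prod_def jmap_add)
    (simp add: jmap_def scale_half b_sym[of "mat n n h"])

lemma defect_point:
  assumes w: "\<And>x y. x \<in> carrier_mat n n \<Longrightarrow> y \<in> carrier_mat n n \<Longrightarrow> x \<circ>\<^sub>J y = A \<Longrightarrow> b x y = w"
    and A: "A \<in> carrier_mat n n" and gh: "mat n n g \<circ>\<^sub>J mat n n h = A"
  shows "defect g h = 0"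
proof -
  \<comment> \<open>\<open>A\<close> and half the identity form a solution themselves, which
    identifies \<open>w\<close> as \<open>jmap A\<close>.\<close>
  have "A \<circ>\<^sub>J ((3 * c) \<cdot>\<^sub>m unit_mat) = A"
  proof -
    have "A * ((3 * c) \<cdot>\<^sub>m unit_mat) = (3 * c) \<cdot>\<^sub>m A" "((3 * c) \<cdot>\<^sub>m unit_mat) * A = (3 * c) \<cdot>\<^sub>m A"
      using A mult_smult_distrib[OF A unit_mat_carrier] mult_smult_assoc_mat[OF unit_mat_carrier A]
      by simp_all
    then show ?thesis
      using A c_half unfolding jordan_prod_def
      by (auto intro!: eq_matI simp: distrib_right[symmetric])
  qed
  then have "b A ((3 * c) \<cdot>\<^sub>m unit_mat) = w" using A by (intro w) auto
  then have "jmap A = w" using A by (simp add: jmap_def b_simps[of unit_mat unit_mat])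
  moreover have "b (mat n n g) (mat n n h) = w" by (rule w) (simp_all add: gh)
  ultimately show ?thesis by (simp add: defect_def gh)
qed

lemma defect_jordan_units:
  assumes "n \<ge> 3" "p < n" "q < n" "p \<noteq> q"
    and w: "\<And>x y. x \<in> carrier_mat n n \<Longrightarrow> y \<in> carrier_mat n n \<Longrightarrow> x \<circ>\<^sub>J y = matrix_unit n p q \<Longrightarrow> b x y = w"
  shows "jordan_units n p q (fun_prod n) fun_unit defect"
proof
  show "fun_prod n (x + y) z = fun_prod n x z + fun_prod n y z"
    "fun_prod n x (y + z) = fun_prod n x y + fun_prod n x z" for x y z :: "nat \<times> nat \<Rightarrow> 'r"
    by (auto simp: fun_prod_def fun_eq_iff sum.distrib algebra_simps)
  show "a = 0" if "a + a = 0" for a :: 'x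
    using that scale_half[of a] scale_right_distrib[of "3 * c" a a] scale_zero by simp
  show "a = 0" if "a + a + a = 0" for a :: 'x
    using that scale_third[of a] scale_right_distrib[of "2 * c" "a + a" a]
      scale_right_distrib[of "2 * c" a a] scale_zero by simp
  fix x y :: "nat \<times> nat \<Rightarrow> 'r"
  let ?u = "fun_unit p q :: nat \<times> nat \<Rightarrow> 'r"
  assume *: "fun_prod n x y + fun_prod n y x = ?u + ?u + ?u + ?u"
  \<comment> \<open>Halving both factors undoes the factor 4 of \<open>f_zero4\<close>, so that
    \<open>defect_point\<close> applies.\<close>
  define x' y' where "x' = (\<lambda>z. 3 * c * x z)" and "y' = (\<lambda>z. 3 * c * y z)"
  have x: "x = x' + x'" and y: "y = y' + y'"
    using c_half by (auto simp: fun_eq_iff x'_def y'_def distrib_right[symmetric])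
  have "fun_prod n x' y' + fun_prod n y' x' = ?u"
  proof
    fix z :: "nat \<times> nat"
    have "(fun_prod n x' y' + fun_prod n y' x') z
        = (3 * c) * ((3 * c) * (fun_prod n x y + fun_prod n y x) z)"
      by (cases z) (simp add: fun_prod_def x'_def y'_def sum_distrib_left algebra_simps)
    also have "\<dots> = (3 * c + 3 * c) * ((3 * c + 3 * c) * ?u z)"
      unfolding * by (simp add: algebra_simps)
    finally show "(fun_prod n x' y' + fun_prod n y' x') z = ?u z" by (simp only: c_half mult_1)
  qed
  then have "mat n n x' \<circ>\<^sub>J mat n n y' = matrix_unit n p q"
    unfolding jordan_prod_def by (metis mat_add_fun mat_fun_prod mat_fun_unit)
  then have "defect x' y' = 0"
    by (intro defect_point[OF w]) (auto simp: matrix_unit_def)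
  then show "defect x y = 0"
    unfolding x y using defect_add defect_sym by (metis add_0)
qed (use assms in \<open>auto simp: fun_prod_unit fun_prod_assoc defect_add defect_one intro: defect_sym\<close>)

lemma defect_eq_0:
  assumes "\<And>i j k l. \<lbrakk>i < n; j < n; k < n; l < n\<rbrakk> \<Longrightarrow> defect (fun_unit i j) (fun_unit k l) = 0"
  shows "defect g h = 0"
proof -
  \<comment> \<open>\<open>ex g\<close> is \<open>g\<close> cut off to indices below
    \<open>n\<close>, a change that \<open>mat n n\<close>, and hence \<open>defect\<close>, does
    not see.\<close>
  define ex where "ex g = (\<Sum>i<n. \<Sum>j<n. (\<lambda>z. g (i, j) * fun_unit i j z))"
    for g :: "nat \<times> nat \<Rightarrow> 'r"
  have ex: "mat n n (ex g) = mat n n g" for g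
  proof (rule eq_matI)
    fix a b assume ab: "a < dim_row (mat n n g)" "b < dim_col (mat n n g)"
    have "ex g (a, b) = (\<Sum>i<n. \<Sum>j<n. if j = b then (if i = a then g (a, b) else 0) else 0)"
      unfolding ex_def sum_fun_apply by (intro sum.cong) (auto simp: fun_unit_def)
    also have "\<dots> = g (a, b)" using ab by simp
    finally show "mat n n (ex g) $$ (a, b) = mat n n g $$ (a, b)" using ab by simp
  qed auto
  have zero: "defect 0 h = 0" for h
    using defect_add[of 0 0 h] by simp
  have sum0: "defect (\<Sum>i\<in>S. g i) h = 0" if "finite S" "\<And>i. i \<in> S \<Longrightarrow> defect (g i) h = 0"
    for S :: "nat set" and g h
    using that by (induction S rule: finite_induct) (auto simp: zero defect_add)
  have ex0: "defect (ex g) h = 0" if "\<And>i j. i < n \<Longrightarrow> j < n \<Longrightarrow> defect (fun_unit i j) h = 0" for g h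
    unfolding ex_def by (intro sum0) (auto simp: defect_smult that scale_zero)
  have "defect (ex g) (ex h) = 0"
    using assms by (intro ex0) (subst defect_sym, auto intro!: ex0)
  then show ?thesis by (simp add: defect_def ex)
qed

lemma jmap_linear: "linear_map_on scale (mat_square n) jmap"
  using mat_square_subset[of n] by (auto simp: linear_map_on_def jmap_add jmap_smult subset_iff)

lemma factors_through_jordan:
  assumes "n \<ge> 3" "p < n" "q < n" "p \<noteq> q"
    and w: "\<And>x y. x \<in> carrier_mat n n \<Longrightarrow> y \<in> carrier_mat n n \<Longrightarrow> x \<circ>\<^sub>J y = matrix_unit n p q \<Longrightarrow> b x y = w"
    and x: "x \<in> carrier_mat n n" and y: "y \<in> carrier_mat n n"
  shows "b x y = jmap (x \<circ>\<^sub>J y)"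
proof -
  have "defect (\<lambda>z. x $$ z) (\<lambda>z. y $$ z) = 0"
    by (rule defect_eq_0) (rule jordan_units.f_e_eq_0[OF defect_jordan_units[OF assms(1-5)]])
  moreover have "mat n n (\<lambda>z. x $$ z) = x" "mat n n (\<lambda>z. y $$ z) = y"
    using x y by (auto intro!: eq_matI)
  ultimately show ?thesis by (simp add: defect_def)
qed

end

theorem theorem2p3:
  fixes n p q :: nat
  assumes "(6 :: 'r::unital_comm_ring) dvd 1"
    and "n \<ge> 3" and "p < n" and "q < n" and "p \<noteq> q"
  shows "jordan_product_determined_point TYPE('x::ab_group_add) n (matrix_unit n p q :: 'r mat)"
proof -
  obtain c :: 'r where c: "6 * c = 1" using assms(1) by (metis dvdE)
  have "\<exists>T. linear_map_on scale (mat_square n) T \<and>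
      (\<forall>x\<in>carrier_mat n n. \<forall>y\<in>carrier_mat n n. b x y = T (x \<circ>\<^sub>J y))"
    if "unital_module scale" "symmetric_bilinear_map scale n b"
      "\<forall>x\<in>carrier_mat n n. \<forall>y\<in>carrier_mat n n. x \<circ>\<^sub>J y = matrix_unit n p q \<longrightarrow> b x y = w"
    for scale :: "'r \<Rightarrow> 'x \<Rightarrow> 'x" and b w
    using jmap_linear[OF that(1,2) c] factors_through_jordan[OF that(1,2) c assms(2-5)] that(3) by blast
  \<comment> \<open>For the converse implication, \<open>w\<close> is the value of \<open>T\<close>
    at the matrix unit.\<close>
  then show ?thesis
    unfolding jordan_product_determined_point_def by (auto simp: matrix_unit_def)
qed

end
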